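(* Suppose $x_*\in T^{-1}(0)$. Let $\{x_k\}$ be an iterative sequence generated by the Linear Contracting PPA (defined in the context). Then $$\|T_\lambda(x_{k+1})\|\le O\big((1-\eta\tau)^{k+1}\big),\qquad \mathtt{Gap}(x_{k+1})\le O\big((1-\eta\tau)^{k+1}\big).$$
   Context: $\mathcal H$ is a real Hilbert space with inner product $\langle\cdot,\cdot\rangle$ and norm $\|\cdot\|$. $T$ is a (set-valued) maximally monotone operator on $\mathcal H$ such that $T^{-1}(0)=\{x:0\in Tx\}$ is nonempty and bounded. For $\lambda>0$, $J_{\lambda T}=(I+\lambda T)^{-1}$ and $T_\lambda=\frac1\lambda(I-J_{\lambda T})$ is the (single-valued) Yosida regularization. For a fixed $D>0$ and the initial point $x_0$ of the iteration, $\mathtt{Gap}(x)=\sup_{\|y-x_0\|\le D}\langle x-y,T_\lambda(y)\rangle$. Linear Contracting PPA: given $\tau\in(0,1)$, $x_{-1}=x_0\in\mathcal H$, set for $k\ge0$ $$v_k=\frac1\tau x_k-\frac{1-\tau}{\tau}x_{k-1}.$$ Given $\lambda>0$, $\eta\in(0,1]$, $\beta\ge0$, $\delta_k\ge0$ with $\sum_{k\ge0}\delta_k<+\infty$, for $k=0,1,\dots$ find $x_{k+1}$ such that $$0=\frac{1}{(1-\eta\tau)^{k+1}}T_\lambda(x_{k+1})-\frac{1-\tau}{(1-\eta\tau)^{k+1}}T_\lambda(x_k)+(v_{k+1}-v_k)+\beta(x_{k+1}-x_k)+g_k,$$ where $g_k\in\mathcal H$ satisfies $\|g_k\|\le\delta_k$.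 "$u_k\le O(r_k)$" means there is a constant $C$ independent of $k$ with $u_k\le Cr_k$ for all $k$. *)

theory Defs
  imports "HOL-Analysis.Analysis"
begin

text \<open>
  A set-valued operator on a real Hilbert space is a function \<open>'a \<Rightarrow> 'a set\<close>, where a Hilbert
  space is a type of sort \<open>{real_inner, complete_space}\<close>.
\<close>

definition monotone_operator :: "('a::real_inner \<Rightarrow> 'a set) \<Rightarrow> bool" where
  "monotone_operator T \<longleftrightarrow> (\<forall>x y. \<forall>u\<in>T x. \<forall>v\<in>T y. 0 \<le> (x - y) \<bullet> (u - v))"

text \<open>The order on operators below is pointwise inclusion, i.e. inclusion of graphs.\<close>

definition maximally_monotone :: "('a::real_inner \<Rightarrow> 'a set) \<Rightarrow> bool" where
  "maximally_monotone T \<longleftrightarrow>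
     monotone_operator T \<and> (\<forall>S. monotone_operator S \<and> T \<le> S \<longrightarrow> S = T)"

definition inverse_operator :: "('a \<Rightarrow> 'a set) \<Rightarrow> 'a \<Rightarrow> 'a set" where
  "inverse_operator T y = {x. y \<in> T x}"

definition resolvent :: "real \<Rightarrow> ('a::real_vector \<Rightarrow> 'a set) \<Rightarrow> 'a \<Rightarrow> 'a set" where
  "resolvent l T = inverse_operator (\<lambda>x. (\<lambda>u. x + l *\<^sub>R u) ` T x)"

text \<open>
  For \<open>l > 0\<close> and maximally monotone \<open>T\<close> on a Hilbert space every value of the resolvent is a
  singleton (Minty), so that \<open>the_elem\<close> selects its only element.
\<close>

definition yosida :: "real \<Rightarrow> ('a::real_vector \<Rightarrow> 'a set) \<Rightarrow> 'a \<Rightarrow> 'a" where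
  "yosida l T x = (1 / l) *\<^sub>R (x - the_elem (resolvent l T x))"

text \<open>The supremum is taken in the extended reals, so an upper bound on it asserts finiteness.\<close>

definition gap :: "real \<Rightarrow> ('a::real_inner \<Rightarrow> 'a set) \<Rightarrow> real \<Rightarrow> 'a \<Rightarrow> 'a \<Rightarrow> ereal" where
  "gap l T D x0 x = (SUP y\<in>{y. norm (y - x0) \<le> D}. ereal ((x - y) \<bullet> yosida l T y))"

text \<open>The case \<open>k = 0\<close> implements the convention \<open>x\<^bsub>-1\<^esub> = x\<^bsub>0\<^esub>\<close>.\<close>

definition extrapolated :: "real \<Rightarrow> (nat \<Rightarrow> 'a::real_vector) \<Rightarrow> nat \<Rightarrow> 'a" where
  "extrapolated \<tau> x k =
     (1 / \<tau>) *\<^sub>R x k - ((1 - \<tau>) / \<tau>) *\<^sub>R (if k = 0 then x 0 else x (k - 1))"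

definition linear_contracting_ppa ::
  "('a::real_inner \<Rightarrow> 'a set) \<Rightarrow> real \<Rightarrow> real \<Rightarrow> real \<Rightarrow> real \<Rightarrow> (nat \<Rightarrow> real) \<Rightarrow> 'a
     \<Rightarrow> (nat \<Rightarrow> 'a) \<Rightarrow> bool" where
  "linear_contracting_ppa T l \<tau> \<eta> \<beta> \<delta> x0 x \<longleftrightarrow>
     x 0 = x0 \<and>
     (\<forall>k. \<exists>g. norm g \<le> \<delta> k \<and>
        0 = (1 / (1 - \<eta> * \<tau>) ^ (k + 1)) *\<^sub>R yosida l T (x (k + 1))
            - ((1 - \<tau>) / (1 - \<eta> * \<tau>) ^ (k + 1)) *\<^sub>R yosida l T (x k)
            + (extrapolated \<tau> x (k + 1) - extrapolated \<tau> x k)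
            + \<beta> *\<^sub>R (x (k + 1) - x k)
            + g)"

end

theory Submission
  imports Defs
begin

text \<open>
  Write \<open>A\<close> for the Yosida regularization, \<open>q = 1 - \<eta> \<tau>\<close>, \<open>v\<close> for the extrapolated points and
  \<open>g\<close> for the errors. Two facts about \<open>A\<close> carry the convergence proof: \<open>A\<close> is a monotone map
  defined on the whole space, and it vanishes at the zeros of \<open>T\<close>. The first one is Minty's
  theorem (\<open>minty_resolvent\<close>), that every point lies in the range of \<open>I + l T\<close>. It is obtained
  variationally. The Fitzpatrick function
  \<open>F (x, u) = sup {x \<bullet> v + u \<bullet> y - y \<bullet> v | v \<in> T y}\<close> of a maximally monotone operator is
  convex, lies above \<open>x \<bullet> u\<close>, and equals it on the graph. Hence \<open>F p + (norm p)\<^sup>2 / 2\<close> is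
  strongly convex and bounded below; it has a minimizer, whose optimality condition says that
  its coordinates, negated and swapped, form a point \<open>(x, - x)\<close> of the graph.

  The iteration is then analysed in two stages. The energy
  \<open>E\<^sub>k = A x\<^sub>k \<bullet> (x\<^sub>k - x\<^sub>*) / q^k + (norm (v\<^sub>k - x\<^sub>*))\<^sup>2 / 2 + \<beta> (norm (x\<^sub>k - x\<^sub>*))\<^sup>2 / 2\<close>
  would be non-increasing without errors, as one sees by pairing the iteration with
  \<open>v\<^sub>k\<^sub>+\<^sub>1 - x\<^sub>*\<close> (\<open>energy_decrease\<close>). With errors it grows by at most
  \<open>\<delta>\<^sub>k sqrt (2 E\<^sub>k\<^sub>+\<^sub>1)\<close>, so that \<open>sqrt E\<^sub>k\<close> grows by at most a summable amount and both \<open>v\<close> and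
  \<open>x\<close> are bounded (\<open>linear_contracting_iterates_bounded\<close>).

  The energy alone would only give the rate \<open>q^(k/2)\<close> for the norm of \<open>A x\<^sub>k\<close>. The full rate comes
  from reading the iteration as a recursion for \<open>b\<^sub>k = A x\<^sub>k / q^k\<close>: with \<open>w = v + \<beta> x\<close> and
  \<open>\<rho> = (1 - \<tau>) / q\<close>, which is at most \<open>1\<close>, it says that
  \<open>b\<^sub>k\<^sub>+\<^sub>1 + w\<^sub>k\<^sub>+\<^sub>1 = \<rho> (b\<^sub>k + w\<^sub>k) + (1 - \<rho>) w\<^sub>k - g\<^sub>k\<close>,
  a convex combination of bounded quantities up to a summable error
  (\<open>linear_contracting_residual_rate\<close>). So \<open>b\<close> is bounded, which is the first claim. The second
  follows because monotonicity gives \<open>(x - y) \<bullet> A y \<le> (x - y) \<bullet> A x\<close>, and \<open>x\<^sub>k - y\<close> is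
  bounded for \<open>y\<close> in the ball of the gap function.
\<close>

section \<open>Minimisation of a strongly convex function\<close>

lemma norm_midpoint_sq:
  fixes p q :: "'v::real_inner"
  shows "(norm ((1/2) *\<^sub>R p + (1/2) *\<^sub>R q))\<^sup>2
         = ((norm p)\<^sup>2 + (norm q)\<^sup>2) / 2 - (norm (p - q))\<^sup>2 / 4"
  by (simp add: power2_norm_eq_inner inner_add_left inner_add_right inner_diff_left
      inner_diff_right inner_commute field_simps)

text \<open>
  A lower semicontinuous convex function with values in \<open>]-\<infinity>, \<infinity>]\<close> is represented here by its
  epigraph \<open>C\<close>, which is closed and convex; this avoids extended reals. Minimizing sequences are
  Cauchy by the parallelogram law: if two points are nearly optimal but far apart, their midpoint
  beats the infimum.
\<close>

lemma convex_epigraph_minimizer: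
  fixes C :: "('v::{real_inner, complete_space} \<times> real) set"
  assumes "convex C" "closed C" "C \<noteq> {}"
    and bdd: "\<And>p r. (p, r) \<in> C \<Longrightarrow> m0 \<le> r + (norm p)\<^sup>2 / 2"
  obtains p0 r0 where "(p0, r0) \<in> C"
    "\<And>p r. (p, r) \<in> C \<Longrightarrow> r0 + (norm p0)\<^sup>2 / 2 \<le> r + (norm p)\<^sup>2 / 2"
proof -
  define h where "h = (\<lambda>z::'v \<times> real. snd z + (norm (fst z))\<^sup>2 / 2)"
  define m where "m = Inf (h ` C)"
  have bb: "bdd_below (h ` C)"
    by (rule bdd_belowI[of _ m0]) (use bdd in \<open>auto simp: h_def\<close>)
  have m_le: "m \<le> h z" if "z \<in> C" for z
    unfolding m_def using that bb by (auto intro: cInf_lower)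
  have "\<exists>z\<in>C. h z < m + inverse (real (Suc n))" for n
  proof -
    have "Inf (h ` C) < m + inverse (real (Suc n))"
      unfolding m_def by simp
    then show ?thesis
      using cInf_lessD[of "h ` C"] \<open>C \<noteq> {}\<close> by blast
  qed
  then obtain z where zC: "\<And>n. z n \<in> C" and zm: "\<And>n. h (z n) < m + inverse (real (Suc n))"
    by metis
  have lim_h: "(\<lambda>n. h (z n)) \<longlonglongrightarrow> m"
  proof (rule tendsto_sandwich)
    show "\<forall>\<^sub>F n in sequentially. m \<le> h (z n)" using m_le zC by simp
    show "\<forall>\<^sub>F n in sequentially. h (z n) \<le> m + inverse (real (Suc n))"
      using zm less_imp_le by (simp add: less_imp_le)
    show "(\<lambda>n. m) \<longlonglongrightarrow> m" by simp
    show "(\<lambda>n. m + inverse (real (Suc n))) \<longlonglongrightarrow> m"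
      using tendsto_add[OF tendsto_const LIMSEQ_inverse_real_of_nat, of m] by simp
  qed
  have est: "(norm (fst (z i) - fst (z j)))\<^sup>2 \<le> 4 * (h (z i) + h (z j) - 2 * m)" for i j
  proof -
    have "(1/2) *\<^sub>R z i + (1/2) *\<^sub>R z j \<in> C"
      using \<open>convex C\<close> zC by (intro convexD) auto
    from m_le[OF this] show ?thesis
      by (simp add: h_def norm_midpoint_sq field_simps)
  qed
  have "Cauchy (\<lambda>n. fst (z n))"
  proof (rule CauchyI)
    fix e :: real assume "e > 0"
    then have "\<forall>\<^sub>F n in sequentially. h (z n) < m + e\<^sup>2 / 8"
      using lim_h by (intro order_tendstoD) auto
    then obtain N where N: "\<And>n. n \<ge> N \<Longrightarrow> h (z n) < m + e\<^sup>2 / 8"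
      by (auto simp: eventually_sequentially)
    show "\<exists>N. \<forall>i\<ge>N. \<forall>j\<ge>N. norm (fst (z i) - fst (z j)) < e"
    proof (intro exI allI impI)
      fix i j assume "i \<ge> N" "j \<ge> N"
      then have "h (z i) < m + e\<^sup>2 / 8" "h (z j) < m + e\<^sup>2 / 8"
        using N by auto
      then have "4 * (h (z i) + h (z j) - 2 * m) < e\<^sup>2" by argo
      then have "(norm (fst (z i) - fst (z j)))\<^sup>2 < e\<^sup>2"
        using est by (rule le_less_trans[rotated])
      then show "norm (fst (z i) - fst (z j)) < e"
        using \<open>e > 0\<close> by (simp add: power_less_imp_less_base)
    qed
  qed
  then obtain p0 where p0: "(\<lambda>n. fst (z n)) \<longlonglongrightarrow> p0"
    using Cauchy_convergent convergent_def by blast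
  define r0 where "r0 = m - (norm p0)\<^sup>2 / 2"
  have "(\<lambda>n. h (z n) - (norm (fst (z n)))\<^sup>2 / 2) \<longlonglongrightarrow> r0"
    unfolding r0_def by (intro tendsto_intros lim_h p0) auto
  then have "(\<lambda>n. snd (z n)) \<longlonglongrightarrow> r0" by (simp add: h_def)
  with p0 have "z \<longlonglongrightarrow> (p0, r0)"
    using tendsto_Pair[of "\<lambda>n. fst (z n)" p0 sequentially "\<lambda>n. snd (z n)" r0] by simp
  then have C0: "(p0, r0) \<in> C"
    using \<open>closed C\<close> zC closed_sequentially by blast
  show ?thesis
  proof (rule that[OF C0])
    fix p r assume "(p, r) \<in> C"
    from m_le[OF this] show "r0 + (norm p0)\<^sup>2 / 2 \<le> r + (norm p)\<^sup>2 / 2"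
      by (simp add: h_def r0_def)
  qed
qed

text \<open>
  First-order optimality: the function represented by \<open>C\<close> has the subgradient \<open>- p0\<close> at the
  minimizer \<open>p0\<close>. Moving from \<open>(p0, r0)\<close> towards \<open>(p, r)\<close> by a fraction \<open>t\<close> cannot decrease the
  objective; divide by \<open>t\<close> and let \<open>t\<close> tend to \<open>0\<close>.
\<close>

lemma convex_epigraph_minimizer_variational:
  fixes C :: "('v::real_inner \<times> real) set"
  assumes "convex C" "(p0, r0) \<in> C"
    and min: "\<And>p r. (p, r) \<in> C \<Longrightarrow> r0 + (norm p0)\<^sup>2 / 2 \<le> r + (norm p)\<^sup>2 / 2"
    and "(p, r) \<in> C"
  shows "r0 - p0 \<bullet> (p - p0) \<le> r"
proof -
  define K where "K = (norm (p - p0))\<^sup>2 / 2"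
  define s where "s = r - r0 + p0 \<bullet> (p - p0)"
  have "0 \<le> s + t * K" if t: "0 < t" "t < 1" for t
  proof -
    have "(1 - t) *\<^sub>R (p0, r0) + t *\<^sub>R (p, r) \<in> C"
      using assms t by (intro convexD) auto
    then have "(p0 + t *\<^sub>R (p - p0), r0 + t * (r - r0)) \<in> C"
      by (simp add: algebra_simps)
    moreover have "(norm (p0 + t *\<^sub>R (p - p0)))\<^sup>2 = (norm p0)\<^sup>2 + 2 * t * (p0 \<bullet> (p - p0)) + 2 * t\<^sup>2 * K"
      unfolding K_def power2_norm_eq_inner
      by (simp add: inner_add_left inner_add_right inner_commute[of "p - p0" p0] power2_eq_square
          distrib_left)
    ultimately have "0 \<le> t * (s + t * K)"
      using min by (fastforce simp: s_def field_simps power2_eq_square)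
    then show ?thesis using t by (simp add: zero_le_mult_iff)
  qed
  moreover have "((\<lambda>t. s + t * K) \<longlongrightarrow> s + 0 * K) (at_right 0)"
    by (intro tendsto_intros)
  ultimately have "0 \<le> s + 0 * K"
    using eventually_at_right_real[of 0 1]
    by (intro tendsto_lowerbound[of _ _ "at_right 0"]) (auto elim: eventually_mono)
  then show ?thesis by (simp add: s_def)
qed

section \<open>Minty's theorem\<close>

text \<open>
  This is the form in which maximality is used: otherwise adding \<open>(x, u)\<close> to the graph would give
  a proper monotone extension.
\<close>

lemma maximally_monotoneD:
  assumes "maximally_monotone T" and "\<And>y v. v \<in> T y \<Longrightarrow> 0 \<le> (x - y) \<bullet> (u - v)"
  shows "u \<in> T x"
proof -
  define S where "S = T(x := insert u (T x))"
  have T: "monotone_operator T" using assms(1) by (simp add: maximally_monotone_def)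
  have rel: "0 \<le> (y - x) \<bullet> (v - u)" if "v \<in> T y" for y v
    using assms(2)[OF that] by (simp add: inner_diff_left inner_diff_right)
  have "monotone_operator S"
    using T assms(2) rel unfolding monotone_operator_def S_def by (auto simp: fun_upd_def)
  moreover have "T \<le> S" by (auto simp: S_def le_fun_def)
  ultimately have "S = T" using assms(1) by (simp add: maximally_monotone_def)
  then show ?thesis by (metis S_def fun_upd_same insertI1)
qed

lemma maximally_monotone_nonempty:
  assumes "maximally_monotone T"
  obtains x u where "u \<in> T x"
  using maximally_monotoneD[OF assms, of 0 0] by blast

text \<open>
  The core of Minty's theorem, \<open>0 \<in> x + T x\<close> for some \<open>x\<close>, in terms of the graph \<open>G\<close> of \<open>T\<close>. The
  set \<open>C\<close> in the proof is the epigraph of the Fitzpatrick function \<open>F\<close> of \<open>G\<close>. Maximality makes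
  \<open>F (x, u) \<ge> x \<bullet> u\<close>, so \<open>F p + (norm p)\<^sup>2 / 2\<close> is nonnegative; let \<open>(x, u)\<close> be its minimizer.
  Combining optimality with \<open>F (y, v) = y \<bullet> v\<close> on \<open>G\<close> shows that \<open>(- u, - x)\<close> is monotonically
  related to all of \<open>G\<close>, with the slack \<open>(norm (x + u))\<^sup>2\<close>. Hence it belongs to \<open>G\<close>, and comparing it
  with itself forces the slack to vanish.
\<close>

lemma maximal_monotone_graph_meets_antidiagonal:
  fixes G :: "('a::{real_inner, complete_space} \<times> 'a) set"
  assumes "G \<noteq> {}"
    and mono: "\<And>x u y v. (x, u) \<in> G \<Longrightarrow> (y, v) \<in> G \<Longrightarrow> 0 \<le> (x - y) \<bullet> (u - v)"
    and maxi: "\<And>x u. (\<And>y v. (y, v) \<in> G \<Longrightarrow> 0 \<le> (x - y) \<bullet> (u - v)) \<Longrightarrow> (x, u) \<in> G"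
  shows "\<exists>x. (x, - x) \<in> G"
proof -
  define C :: "(('a \<times> 'a) \<times> real) set" where
    "C = {z. \<forall>g\<in>G. fst z \<bullet> (snd g, fst g) - fst g \<bullet> snd g \<le> snd z}"
  have C_iff: "((x, u), r) \<in> C \<longleftrightarrow> (\<forall>(y, v)\<in>G. x \<bullet> v + u \<bullet> y - y \<bullet> v \<le> r)" for x u r
    by (auto simp: C_def)
  \<comment> \<open>An intersection of closed half-spaces, whence convexity and closedness.\<close>
  have C_Inter: "C = (\<Inter>g\<in>G. {z. ((snd g, fst g), -1) \<bullet> z \<le> fst g \<bullet> snd g})"
    by (auto simp: C_def inner_prod_def inner_commute algebra_simps)
  have "convex C" unfolding C_Inter by (intro convex_INT convex_halfspace_le)
  have "closed C" unfolding C_Inter by (intro closed_INT ballI closed_halfspace_le)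
  have G_C: "((x, u), x \<bullet> u) \<in> C" if "(x, u) \<in> G" for x u
    using mono[OF that] by (auto simp: C_iff inner_diff_left inner_diff_right inner_commute algebra_simps)
  have fitz: "x \<bullet> u \<le> r" if C: "((x, u), r) \<in> C" for x u r
  proof (rule ccontr)
    assume *: "\<not> x \<bullet> u \<le> r"
    have "(x, u) \<in> G"
    proof (rule maxi)
      fix y v assume "(y, v) \<in> G"
      then have "x \<bullet> v + u \<bullet> y - y \<bullet> v \<le> r" using C by (auto simp: C_iff)
      then show "0 \<le> (x - y) \<bullet> (u - v)"
        using * by (simp add: inner_diff_left inner_diff_right inner_commute algebra_simps)
    qed
    then have "x \<bullet> u \<le> r" using C by (auto simp: C_iff inner_commute)
    with * show False by simp
  qed
  have sq: "(norm (x + u))\<^sup>2 = 2 * (x \<bullet> u) + (norm x)\<^sup>2 + (norm u)\<^sup>2" for x u :: 'a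
    by (simp add: power2_norm_eq_inner inner_add_left inner_add_right inner_commute)
  have nP: "(norm (x, u))\<^sup>2 = (norm x)\<^sup>2 + (norm u)\<^sup>2" for x u :: 'a
    by (simp add: norm_Pair)
  have "C \<noteq> {}" using \<open>G \<noteq> {}\<close> G_C by fastforce
  moreover have "0 \<le> r + (norm p)\<^sup>2 / 2" if C: "(p, r) \<in> C" for p r
  proof (cases p)
    case (Pair x u)
    then have "0 \<le> (norm (x + u))\<^sup>2" "x \<bullet> u \<le> r" using C fitz by auto
    then have "0 \<le> r + ((norm x)\<^sup>2 + (norm u)\<^sup>2) / 2" unfolding sq by argo
    then show ?thesis by (simp add: Pair nP)
  qed
  ultimately obtain p0 r0 where p0: "(p0, r0) \<in> C"
    and min: "\<And>p r. (p, r) \<in> C \<Longrightarrow> r0 + (norm p0)\<^sup>2 / 2 \<le> r + (norm p)\<^sup>2 / 2"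
    using convex_epigraph_minimizer[OF \<open>convex C\<close> \<open>closed C\<close>, of 0] by blast
  obtain x u where xu: "p0 = (x, u)" by (cases p0)
  have key: "(norm (x + u))\<^sup>2 \<le> (- u - y) \<bullet> (- x - v)" if "(y, v) \<in> G" for y v
  proof -
    have "r0 - (x, u) \<bullet> ((y, v) - (x, u)) \<le> y \<bullet> v"
      using convex_epigraph_minimizer_variational[OF \<open>convex C\<close> p0 min G_C[OF that]] xu by blast
    moreover have "x \<bullet> u \<le> r0" using fitz p0 xu by blast
    ultimately show ?thesis
      unfolding sq by (simp add: inner_diff_left inner_diff_right power2_norm_eq_inner inner_commute)
  qed
  have "(- u, - x) \<in> G"
    by (rule maxi) (use key in \<open>meson order_trans zero_le_power2\<close>)
  with key[OF this] have "x + u = 0" by simp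
  then have "- u = x" by (metis minus_unique add.commute)
  with \<open>(- u, - x) \<in> G\<close> show ?thesis by auto
qed

text \<open>
  The operator \<open>l T - z\<close> inherits maximal monotonicity from \<open>T\<close>, and \<open>- x \<in> l T x - z\<close> means
  \<open>z \<in> x + l T x\<close>.
\<close>

theorem minty_resolvent:
  fixes T :: "'a::{real_inner, complete_space} \<Rightarrow> 'a set"
  assumes T: "maximally_monotone T" and "l > 0"
  obtains w u where "u \<in> T w" "z = w + l *\<^sub>R u"
proof -
  define G where "G = {(x, l *\<^sub>R u - z) | x u. u \<in> T x}"
  have "\<exists>x. (x, - x) \<in> G"
  proof (rule maximal_monotone_graph_meets_antidiagonal)
    obtain y v where "v \<in> T y" using maximally_monotone_nonempty[OF T] .
    then show "G \<noteq> {}" by (auto simp: G_def)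
  next
    fix x u y v assume "(x, u) \<in> G" "(y, v) \<in> G"
    then obtain u' v' where uv: "u' \<in> T x" "v' \<in> T y" "u = l *\<^sub>R u' - z" "v = l *\<^sub>R v' - z"
      by (auto simp: G_def)
    then have "0 \<le> (x - y) \<bullet> (u' - v')"
      using T by (auto simp: maximally_monotone_def monotone_operator_def)
    moreover have "u - v = l *\<^sub>R (u' - v')" by (simp add: uv scaleR_diff_right)
    ultimately show "0 \<le> (x - y) \<bullet> (u - v)" using \<open>l > 0\<close> by simp
  next
    fix x u assume *: "\<And>y v. (y, v) \<in> G \<Longrightarrow> 0 \<le> (x - y) \<bullet> (u - v)"
    define u' where "u' = (1 / l) *\<^sub>R (u + z)"
    have u: "u = l *\<^sub>R u' - z" using \<open>l > 0\<close> by (simp add: u'_def)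
    have "u' \<in> T x"
    proof (rule maximally_monotoneD[OF T])
      fix y v assume "v \<in> T y"
      then have "0 \<le> (x - y) \<bullet> (u - (l *\<^sub>R v - z))" by (intro *) (auto simp: G_def)
      also have "u - (l *\<^sub>R v - z) = l *\<^sub>R (u' - v)" by (simp add: u scaleR_diff_right)
      finally show "0 \<le> (x - y) \<bullet> (u' - v)" using \<open>l > 0\<close> by (simp add: zero_le_mult_iff)
    qed
    then show "(x, u) \<in> G" using u by (auto simp: G_def)
  qed
  then obtain x u where "u \<in> T x" "- x = l *\<^sub>R u - z" by (auto simp: G_def)
  then show ?thesis by (intro that[of u x]) (auto simp: algebra_simps)
qed

section \<open>The Yosida regularization\<close>

lemma monotone_resolvent_unique:
  assumes "monotone_operator T" "l > 0" "u \<in> T w" "v \<in> T y" "w + l *\<^sub>R u = y + l *\<^sub>R v"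
  shows "w = y"
proof -
  have "w - y = - (l *\<^sub>R (u - v))" using assms(5) by (simp add: algebra_simps)
  moreover have "0 \<le> (w - y) \<bullet> (u - v)" using assms by (auto simp: monotone_operator_def)
  ultimately have "l * ((u - v) \<bullet> (u - v)) \<le> 0" by simp
  then have "u - v = 0"
    using \<open>l > 0\<close> by (metis inner_ge_zero inner_eq_zero_iff mult_le_0_iff not_less order_antisym)
  then show ?thesis using assms(5) by simp
qed

text \<open>
  The Yosida regularization at \<open>z\<close> is the \<open>T\<close>-part \<open>u\<close> of the decomposition \<open>z = w + l u\<close>,
  \<open>u \<in> T w\<close>; which of the decompositions does not matter, as there is at most one.
\<close>

lemma yosida_eqI:
  assumes "monotone_operator T" "l > 0" "u \<in> T w"
  shows "yosida l T (w + l *\<^sub>R u) = u"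
proof -
  have "resolvent l T (w + l *\<^sub>R u) = {w}"
    using monotone_resolvent_unique[OF assms] assms(3)
    by (force simp: resolvent_def inverse_operator_def)
  then show ?thesis using \<open>l > 0\<close> by (simp add: yosida_def)
qed

lemma yosida_monotone:
  fixes T :: "'a::{real_inner, complete_space} \<Rightarrow> 'a set"
  assumes T: "maximally_monotone T" and "l > 0"
  shows "0 \<le> (x - y) \<bullet> (yosida l T x - yosida l T y)"
proof -
  have mono: "monotone_operator T" using T by (simp add: maximally_monotone_def)
  obtain w u where x: "u \<in> T w" "x = w + l *\<^sub>R u" using minty_resolvent[OF assms] .
  obtain w' v where y: "v \<in> T w'" "y = w' + l *\<^sub>R v" using minty_resolvent[OF assms] .
  have "x - y = (w - w') + l *\<^sub>R (u - v)" by (simp add: x y algebra_simps)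
  moreover have "0 \<le> (w - w') \<bullet> (u - v)" using mono x y by (auto simp: monotone_operator_def)
  moreover have "yosida l T x = u" "yosida l T y = v"
    using yosida_eqI[OF mono \<open>l > 0\<close>] x y by auto
  ultimately show ?thesis using \<open>l > 0\<close> by (simp add: inner_add_left)
qed

section \<open>Sequences driven by summable errors\<close>

lemma bounded_by_summable_increments:
  fixes s d :: "nat \<Rightarrow> real"
  assumes "\<And>k. s (Suc k) \<le> s k + d k" "\<And>k. 0 \<le> d k" "summable d"
  shows "s k \<le> s 0 + suminf d"
proof -
  have "s k \<le> s 0 + (\<Sum>i<k. d i)"
  proof (induction k)
    case (Suc k)
    then show ?case using assms(1)[of k] by simp
  qed simp
  also have "(\<Sum>i<k. d i) \<le> suminf d" using assms by (intro sum_le_suminf) auto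
  finally show ?thesis by simp
qed

text \<open>
  An error proportional to the square root of the new energy costs only an additive term after
  taking roots. The square root enters because the error is paired with a vector whose squared norm
  the energy controls.
\<close>

lemma sqrt_le_of_quadratic_increment:
  fixes E E' d :: real
  assumes "0 \<le> E" "0 \<le> E'" "0 \<le> d" "E' \<le> E + d * sqrt E'"
  shows "sqrt E' \<le> sqrt E + d"
proof (rule ccontr)
  assume "\<not> sqrt E' \<le> sqrt E + d"
  then have *: "sqrt E + d < sqrt E'" by simp
  have "sqrt E \<le> sqrt E'" using * \<open>0 \<le> d\<close> by linarith
  then have "sqrt E * sqrt E \<le> sqrt E * sqrt E'"
    by (rule mult_left_mono) (simp add: \<open>0 \<le> E\<close>)
  then have "E + d * sqrt E' \<le> sqrt E * sqrt E' + d * sqrt E'"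
    using assms by simp
  also have "\<dots> = (sqrt E + d) * sqrt E'" by (simp add: algebra_simps)
  also have "\<dots> < sqrt E' * sqrt E'"
  proof (rule mult_strict_right_mono[OF *])
    show "0 < sqrt E'" using * assms by (smt (verit) real_sqrt_ge_zero)
  qed
  also have "\<dots> = E'" using assms by simp
  finally show False using assms by simp
qed

text \<open>
  The bound is uniform in \<open>\<rho>\<close>, since \<open>max (c k) W\<close> grows at most by \<open>d k\<close>. For \<open>\<rho> < 1\<close> a geometric
  series would do, but \<open>\<rho> = 1\<close> occurs for \<open>\<eta> = 1\<close>.
\<close>

lemma relaxed_sequence_bounded:
  fixes c :: "nat \<Rightarrow> real"
  assumes "\<And>k. c (Suc k) \<le> \<rho> * c k + (1 - \<rho>) * W + d k"
    and "0 \<le> \<rho>" "\<rho> \<le> 1" "\<And>k. 0 \<le> d k" "summable d"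
  shows "c k \<le> max (c 0) W + suminf d"
proof -
  define s where "s k = max (c k) W" for k
  have "s (Suc k) \<le> s k + d k" for k
  proof -
    have "\<rho> * c k + (1 - \<rho>) * W \<le> \<rho> * s k + (1 - \<rho>) * s k"
      using assms by (intro add_mono mult_left_mono) (auto simp: s_def)
    also have "\<dots> = s k" by (simp add: algebra_simps)
    finally have "c (Suc k) \<le> s k + d k" using assms(1)[of k] by linarith
    moreover have "W \<le> s k + d k" using assms(4)[of k] unfolding s_def by linarith
    ultimately show ?thesis by (simp add: s_def)
  qed
  from bounded_by_summable_increments[of s d, OF this assms(4,5)]
  show ?thesis unfolding s_def by (meson max.cobounded1 order_trans)
qed

section \<open>The iteration\<close>

lemma extrapolated_0: "\<tau> \<noteq> 0 \<Longrightarrow> extrapolated \<tau> x 0 = x 0"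
  by (simp add: extrapolated_def flip: scaleR_diff_left) (simp add: field_simps)

lemma extrapolated_Suc:
  "\<tau> \<noteq> 0 \<Longrightarrow> extrapolated \<tau> x (Suc k) = x (Suc k) + ((1 - \<tau>) / \<tau>) *\<^sub>R (x (Suc k) - x k)"
  by (simp add: extrapolated_def algebra_simps diff_divide_distrib)

text \<open>Through this identity, a bound on the extrapolated points passes to the iterates.\<close>

lemma extrapolated_convex_combination:
  "\<tau> \<noteq> 0 \<Longrightarrow> x (Suc k) = (1 - \<tau>) *\<^sub>R x k + \<tau> *\<^sub>R extrapolated \<tau> x (Suc k)"
  by (simp add: extrapolated_def scaleR_diff_right)

text \<open>
  Why \<open>v\<close> is extrapolated with the factor \<open>(1 - \<tau>) / \<tau>\<close>: pairing the contracted difference of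
  residuals with it yields exactly a contracted difference of the pairings \<open>a \<bullet> e\<close>, plus a
  monotonicity term. Below, \<open>e\<close> is the distance vector to the solution and primes mark the next step.
\<close>

lemma inner_contracted_difference:
  fixes a a' e e' :: "'a::real_inner"
  assumes "\<tau> \<noteq> 0"
  shows "(a' - (1 - \<tau>) *\<^sub>R a) \<bullet> (e' + ((1 - \<tau>) / \<tau>) *\<^sub>R (e' - e))
    = a' \<bullet> e' - (1 - \<tau>) * (a \<bullet> e) + ((1 - \<tau>) / \<tau>) * ((e' - e) \<bullet> (a' - a))"
  using assms
  by (simp add: inner_add_left inner_add_right inner_diff_left inner_diff_right inner_commute
      field_simps)

lemma inner_diff_self:
  fixes v v' :: "'a::real_inner"
  shows "(v' - v) \<bullet> v' = ((norm v')\<^sup>2 - (norm v)\<^sup>2 + (norm (v' - v))\<^sup>2) / 2"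
  by (simp add: power2_norm_eq_inner inner_diff_left inner_diff_right inner_commute field_simps)

text \<open>
  Here \<open>a, e, v\<close> stand for \<open>A x\<^sub>k\<close>, \<open>x\<^sub>k - x\<^sub>*\<close> and \<open>v\<^sub>k - x\<^sub>*\<close>, primes mark the step \<open>k + 1\<close>, and
  \<open>Q = q^k\<close>. The inequality results from pairing the iteration with \<open>v'\<close>. Apart from
  the error, each of its terms then bounds one difference of the energy: the residual term by
  monotonicity, where \<open>1 - \<tau> \<le> q\<close> makes the growth of the weights \<open>1 / q^k\<close> affordable, and the
  two others by \<open>inner_diff_self\<close>.
\<close>

lemma energy_decrease:
  fixes a a' e e' v g :: "'a::real_inner"
  assumes \<tau>: "0 < \<tau>" "\<tau> < 1" and q: "1 - \<tau> \<le> q" and Q: "0 < Q" "0 < q" and "0 \<le> \<beta>"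
    and mono: "0 \<le> (e' - e) \<bullet> (a' - a)" and ae: "0 \<le> a \<bullet> e"
    and v': "v' = e' + ((1 - \<tau>) / \<tau>) *\<^sub>R (e' - e)"
    and step: "0 = (1 / (q * Q)) *\<^sub>R (a' - (1 - \<tau>) *\<^sub>R a) + (v' - v) + \<beta> *\<^sub>R (e' - e) + g"
  shows "a' \<bullet> e' / (q * Q) + (norm v')\<^sup>2 / 2 + \<beta> / 2 * (norm e')\<^sup>2
    \<le> a \<bullet> e / Q + (norm v)\<^sup>2 / 2 + \<beta> / 2 * (norm e)\<^sup>2 + norm g * norm v'"
proof -
  have "0 = ((1 / (q * Q)) *\<^sub>R (a' - (1 - \<tau>) *\<^sub>R a) + (v' - v) + \<beta> *\<^sub>R (e' - e) + g) \<bullet> v'"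
    using step by simp
  also have "\<dots> = (a' - (1 - \<tau>) *\<^sub>R a) \<bullet> v' / (q * Q) + (v' - v) \<bullet> v' + \<beta> * ((e' - e) \<bullet> v') + g \<bullet> v'"
    by (simp add: inner_add_left)
  finally have sum0: "(a' - (1 - \<tau>) *\<^sub>R a) \<bullet> v' / (q * Q) + (v' - v) \<bullet> v' + \<beta> * ((e' - e) \<bullet> v') + g \<bullet> v' = 0"
    by simp
  have "a' \<bullet> e' - q * (a \<bullet> e) \<le> a' \<bullet> e' - (1 - \<tau>) * (a \<bullet> e)"
    using mult_right_mono[OF q ae] by simp
  also have "\<dots> \<le> (a' - (1 - \<tau>) *\<^sub>R a) \<bullet> v'"
    unfolding v' using \<tau> mono by (subst inner_contracted_difference) auto
  finally have "(a' \<bullet> e' - q * (a \<bullet> e)) / (q * Q) \<le> (a' - (1 - \<tau>) *\<^sub>R a) \<bullet> v' / (q * Q)"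
    using Q by (intro divide_right_mono) auto
  then have 1: "a' \<bullet> e' / (q * Q) - a \<bullet> e / Q \<le> (a' - (1 - \<tau>) *\<^sub>R a) \<bullet> v' / (q * Q)"
    using Q by (simp add: diff_divide_distrib)
  have 2: "((norm v')\<^sup>2 - (norm v)\<^sup>2) / 2 \<le> (v' - v) \<bullet> v'"
    unfolding inner_diff_self by simp
  have "((norm e')\<^sup>2 - (norm e)\<^sup>2) / 2 \<le> (e' - e) \<bullet> e'"
    unfolding inner_diff_self by simp
  also have "\<dots> \<le> (e' - e) \<bullet> v'"
    unfolding v' using \<tau> by (simp add: inner_add_right)
  finally have 3: "\<beta> * (((norm e')\<^sup>2 - (norm e)\<^sup>2) / 2) \<le> \<beta> * ((e' - e) \<bullet> v')"
    using \<open>0 \<le> \<beta>\<close> by (rule mult_left_mono)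
  have 4: "- (norm g * norm v') \<le> g \<bullet> v'"
    using Cauchy_Schwarz_ineq2[of g v'] by linarith
  have "\<beta> * (((norm e')\<^sup>2 - (norm e)\<^sup>2) / 2) = \<beta> / 2 * (norm e')\<^sup>2 - \<beta> / 2 * (norm e)\<^sup>2"
    by (simp add: algebra_simps diff_divide_distrib)
  then show ?thesis using sum0 1 2 3 4 by argo
qed

text \<open>
  The quantity \<open>E\<close> in the proof is the energy. Its term in \<open>v\<close> is the one that matters: it bounds the
  factor of the error, closing the estimate of \<open>E\<close>, and it also bounds \<open>v\<close>. The iterates follow,
  being convex combinations of earlier ones and of extrapolated points.
\<close>

lemma linear_contracting_iterates_bounded:
  fixes A :: "'a::real_inner \<Rightarrow> 'a" and x g :: "nat \<Rightarrow> 'a" and xstar :: 'a and \<tau> :: real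
  defines "v \<equiv> extrapolated \<tau> x"
  assumes \<tau>: "0 < \<tau>" "\<tau> < 1" and q: "1 - \<tau> \<le> q" and "0 \<le> \<beta>"
    and mono: "\<And>x y. 0 \<le> (x - y) \<bullet> (A x - A y)" and zero: "A xstar = 0"
    and \<delta>: "\<And>k. norm (g k) \<le> \<delta> k" "summable \<delta>"
    and step: "\<And>k. 0 = (1 / q ^ Suc k) *\<^sub>R (A (x (Suc k)) - (1 - \<tau>) *\<^sub>R A (x k))
      + (v (Suc k) - v k) + \<beta> *\<^sub>R (x (Suc k) - x k) + g k"
  obtains R where "\<And>k. norm (v k) \<le> R" "\<And>k. norm (x k) \<le> R"
proof -
  have "0 < q" using \<tau> q by linarith
  have \<delta>0: "0 \<le> \<delta> k" for k using \<delta>(1)[of k] norm_ge_zero order_trans by blast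
  define E where "E k = A (x k) \<bullet> (x k - xstar) / q ^ k + (norm (v k - xstar))\<^sup>2 / 2
    + \<beta> / 2 * (norm (x k - xstar))\<^sup>2" for k
  have pair: "0 \<le> A (x k) \<bullet> (x k - xstar)" for k
    using mono[of "x k" xstar] zero by (simp add: inner_commute)
  have v_E: "(norm (v k - xstar))\<^sup>2 \<le> 2 * E k" for k
    using pair[of k] \<open>0 < q\<close> \<open>0 \<le> \<beta>\<close> by (simp add: E_def)
  have E0: "0 \<le> E k" for k using v_E[of k] by (smt (verit) zero_le_power2)
  have E_step: "E (Suc k) \<le> E k + (sqrt 2 * \<delta> k) * sqrt (E (Suc k))" for k
  proof -
    have "E (Suc k) \<le> E k + norm (g k) * norm (v (Suc k) - xstar)"
      unfolding E_def power_Suc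
    proof (rule energy_decrease[OF \<tau> q])
      show "0 < q ^ k" "0 < q" using \<open>0 < q\<close> by auto
      show "0 \<le> \<beta>" by fact
      show "0 \<le> (x (Suc k) - xstar - (x k - xstar)) \<bullet> (A (x (Suc k)) - A (x k))"
        using mono[of "x (Suc k)" "x k"] by simp
      show "0 \<le> A (x k) \<bullet> (x k - xstar)" by (rule pair)
      show "v (Suc k) - xstar = x (Suc k) - xstar
          + ((1 - \<tau>) / \<tau>) *\<^sub>R (x (Suc k) - xstar - (x k - xstar))"
        using \<tau> by (simp add: v_def extrapolated_Suc)
      show "0 = (1 / (q * q ^ k)) *\<^sub>R (A (x (Suc k)) - (1 - \<tau>) *\<^sub>R A (x k))
          + (v (Suc k) - xstar - (v k - xstar))
          + \<beta> *\<^sub>R (x (Suc k) - xstar - (x k - xstar)) + g k"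
        using step[of k] by simp
    qed
    also have "norm (v (Suc k) - xstar) \<le> sqrt (2 * E (Suc k))"
      using v_E by (rule real_le_rsqrt)
    then have "norm (g k) * norm (v (Suc k) - xstar) \<le> \<delta> k * sqrt (2 * E (Suc k))"
      using \<delta>(1) \<delta>0 by (intro mult_mono) auto
    finally show ?thesis by (simp add: real_sqrt_mult mult_ac)
  qed
  have "sqrt (E (Suc k)) \<le> sqrt (E k) + sqrt 2 * \<delta> k" for k
    using E0 \<delta>0 E_step by (intro sqrt_le_of_quadratic_increment) auto
  then have sE: "sqrt (E k) \<le> sqrt (E 0) + (\<Sum>k. sqrt 2 * \<delta> k)" for k
    using \<delta>0 \<delta>(2) by (intro bounded_by_summable_increments summable_mult) auto
  define S where "S = sqrt 2 * (sqrt (E 0) + (\<Sum>k. sqrt 2 * \<delta> k)) + norm xstar"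
  have v_S: "norm (v k) \<le> S" for k
  proof -
    have "norm (v k - xstar) \<le> sqrt (2 * E k)" using v_E by (rule real_le_rsqrt)
    also have "\<dots> = sqrt 2 * sqrt (E k)" by (simp add: real_sqrt_mult)
    also have "\<dots> \<le> sqrt 2 * (sqrt (E 0) + (\<Sum>k. sqrt 2 * \<delta> k))"
      by (intro mult_left_mono sE) auto
    finally show ?thesis using norm_triangle_sub[of "v k" xstar] by (simp add: S_def)
  qed
  moreover have "norm (x k) \<le> S" for k
  proof (induction k)
    case 0
    then show ?case using v_S[of 0] \<tau> by (simp add: v_def extrapolated_0)
  next
    case (Suc k)
    have "x (Suc k) = (1 - \<tau>) *\<^sub>R x k + \<tau> *\<^sub>R v (Suc k)"
      using \<tau> unfolding v_def by (intro extrapolated_convex_combination) auto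
    then have "norm (x (Suc k)) \<le> (1 - \<tau>) * norm (x k) + \<tau> * norm (v (Suc k))"
      using norm_triangle_ineq[of "(1 - \<tau>) *\<^sub>R x k" "\<tau> *\<^sub>R v (Suc k)"] \<tau> by simp
    also have "\<dots> \<le> (1 - \<tau>) * S + \<tau> * S"
      using \<tau> Suc v_S by (intro add_mono mult_left_mono) auto
    finally show ?case by (simp add: algebra_simps)
  qed
  ultimately show ?thesis using that by blast
qed

text \<open>
  Multiplied out with the weights, the iteration is a telescoping relation up to the contraction
  factor \<open>\<rho>\<close>, so the increments of \<open>w\<close> need not be summable: it is enough to absorb \<open>w\<close> into the
  rescaled residual \<open>b\<close>, which leaves only the bounded term \<open>(1 - \<rho>) w\<close>.
\<close>

lemma linear_contracting_residual_rate:
  fixes a w g :: "nat \<Rightarrow> 'a::real_normed_vector"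
  assumes \<tau>: "\<tau> < 1" and q: "1 - \<tau> \<le> q"
    and w: "\<And>k. norm (w k) \<le> W"
    and \<delta>: "\<And>k. norm (g k) \<le> \<delta> k" "summable \<delta>"
    and step: "\<And>k. 0 = (1 / q ^ Suc k) *\<^sub>R (a (Suc k) - (1 - \<tau>) *\<^sub>R a k)
      + (w (Suc k) - w k) + g k"
  obtains C where "\<And>k. norm (a k) \<le> C * q ^ k"
proof -
  have "0 < q" using \<tau> q by linarith
  have \<delta>0: "0 \<le> \<delta> k" for k using \<delta>(1)[of k] norm_ge_zero order_trans by blast
  define \<rho> where "\<rho> = (1 - \<tau>) / q"
  have \<rho>: "0 \<le> \<rho>" "\<rho> \<le> 1" using \<tau> q \<open>0 < q\<close> by (auto simp: \<rho>_def)
  define b where "b k = (1 / q ^ k) *\<^sub>R a k" for k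
  define c where "c k = b k + w k" for k
  have c_Suc: "c (Suc k) = \<rho> *\<^sub>R c k + (1 - \<rho>) *\<^sub>R w k - g k" for k
  proof -
    have "(1 / q ^ Suc k) *\<^sub>R (a (Suc k) - (1 - \<tau>) *\<^sub>R a k) = b (Suc k) - \<rho> *\<^sub>R b k"
      by (simp add: b_def \<rho>_def scaleR_diff_right mult.commute)
    then have "0 = b (Suc k) - \<rho> *\<^sub>R b k + (w (Suc k) - w k) + g k" using step[of k] by metis
    then show ?thesis by (simp add: c_def algebra_simps eq_diff_eq)
  qed
  have "norm (c (Suc k)) \<le> \<rho> * norm (c k) + (1 - \<rho>) * W + \<delta> k" for k
  proof -
    have "norm (c (Suc k)) \<le> norm (\<rho> *\<^sub>R c k) + norm ((1 - \<rho>) *\<^sub>R w k) + norm (g k)"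
      unfolding c_Suc by (meson norm_triangle_ineq norm_triangle_ineq4 add_right_mono order_trans)
    also have "\<dots> \<le> \<rho> * norm (c k) + (1 - \<rho>) * W + \<delta> k"
      using \<rho> w \<delta>(1) by (intro add_mono) (auto intro: mult_left_mono)
    finally show ?thesis .
  qed
  then have c_bd: "norm (c k) \<le> max (norm (c 0)) W + suminf \<delta>" for k
    using relaxed_sequence_bounded[where c = "\<lambda>k. norm (c k)"] \<rho> \<delta>0 \<delta>(2) by blast
  show ?thesis
  proof (rule that)
    fix k
    have "norm (b k) \<le> norm (c k) + norm (w k)"
      using norm_triangle_ineq4[of "c k" "w k"] by (simp add: c_def)
    also have "\<dots> \<le> max (norm (c 0)) W + suminf \<delta> + W" by (intro add_mono c_bd w)
    finally have "norm (b k) * q ^ k \<le> (max (norm (c 0)) W + suminf \<delta> + W) * q ^ k"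
      using \<open>0 < q\<close> by (intro mult_right_mono) auto
    then show "norm (a k) \<le> (max (norm (c 0)) W + suminf \<delta> + W) * q ^ k"
      using \<open>0 < q\<close> by (simp add: b_def)
  qed
qed

text \<open>
  By monotonicity the variable residual at \<open>y\<close> may be replaced by the one at \<open>x\<close>, after which only
  the distance from \<open>x\<close> to \<open>y\<close> depends on \<open>y\<close>.
\<close>

lemma gap_le_of_monotone:
  assumes "\<And>x y. 0 \<le> (x - y) \<bullet> (yosida l T x - yosida l T y)"
  shows "gap l T D x0 x \<le> ereal (norm (yosida l T x) * (norm (x - x0) + D))"
  unfolding gap_def
proof (rule SUP_least)
  fix y assume "y \<in> {y. norm (y - x0) \<le> D}"
  then have y: "norm (x - y) \<le> norm (x - x0) + D"
    using norm_triangle_ineq4[of "x - x0" "y - x0"] by simp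
  have "(x - y) \<bullet> yosida l T y \<le> (x - y) \<bullet> yosida l T x"
    using assms[of x y] by (simp add: inner_diff_right)
  also have "\<dots> \<le> norm (x - y) * norm (yosida l T x)" by (rule norm_cauchy_schwarz)
  also have "\<dots> \<le> norm (yosida l T x) * (norm (x - x0) + D)"
    using mult_left_mono[OF y norm_ge_zero[of "yosida l T x"]] by (simp add: mult.commute)
  finally show "ereal ((x - y) \<bullet> yosida l T y) \<le> ereal (norm (yosida l T x) * (norm (x - x0) + D))"
    by simp
qed

theorem theorem6:
  fixes T :: "'a::{real_inner, complete_space} \<Rightarrow> 'a set"
    and l D \<tau> \<eta> \<beta> :: real
    and \<delta> :: "nat \<Rightarrow> real"
    and x0 xstar :: 'a
    and x :: "nat \<Rightarrow> 'a"
  assumes "maximally_monotone T"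
    and "inverse_operator T 0 \<noteq> {}" and "bounded (inverse_operator T 0)"
    and "l > 0" and "D > 0"
    and "0 < \<tau>" and "\<tau> < 1"
    and "0 < \<eta>" and "\<eta> \<le> 1"
    and "\<beta> \<ge> 0"
    and "\<And>k. \<delta> k \<ge> 0" and "summable \<delta>"
    and "xstar \<in> inverse_operator T 0"
    and "linear_contracting_ppa T l \<tau> \<eta> \<beta> \<delta> x0 x"
  shows "(\<exists>C::real. \<forall>k. norm (yosida l T (x (k + 1))) \<le> C * (1 - \<eta> * \<tau>) ^ (k + 1)) \<and>
         (\<exists>C::real. \<forall>k. gap l T D x0 (x (k + 1)) \<le> ereal (C * (1 - \<eta> * \<tau>) ^ (k + 1)))"
proof -
  define A where "A = yosida l T"
  define q where "q = 1 - \<eta> * \<tau>"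
  define v where "v = extrapolated \<tau> x"
  have q: "1 - \<tau> \<le> q" using mult_right_mono[OF \<open>\<eta> \<le> 1\<close>, of \<tau>] \<open>0 < \<tau>\<close> by (simp add: q_def)
  then have "0 < q" using \<open>\<tau> < 1\<close> by linarith
  have mono: "0 \<le> (y - z) \<bullet> (A y - A z)" for y z
    unfolding A_def by (intro yosida_monotone assms)
  have zero: "A xstar = 0"
    using yosida_eqI[of T l 0 xstar] assms(1,4,13)
    by (simp add: A_def maximally_monotone_def inverse_operator_def)
  from assms(14) obtain g where g: "\<And>k. norm (g k) \<le> \<delta> k"
    and g0: "\<And>k. 0 = (1 / q ^ (k + 1)) *\<^sub>R A (x (k + 1)) - ((1 - \<tau>) / q ^ (k + 1)) *\<^sub>R A (x k)
       + (v (k + 1) - v k) + \<beta> *\<^sub>R (x (k + 1) - x k) + g k"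
    unfolding linear_contracting_ppa_def A_def q_def v_def by metis
  have step: "0 = (1 / q ^ Suc k) *\<^sub>R (A (x (Suc k)) - (1 - \<tau>) *\<^sub>R A (x k))
      + (v (Suc k) - v k) + \<beta> *\<^sub>R (x (Suc k) - x k) + g k" for k
    using g0[of k] by (simp add: scaleR_diff_right)
  obtain R where v_R: "\<And>k. norm (v k) \<le> R" and x_R: "\<And>k. norm (x k) \<le> R"
    using linear_contracting_iterates_bounded[where A = A and x = x,
        OF assms(6,7) q assms(10) mono zero g assms(12)] step
    unfolding v_def by metis
  have w_R: "norm (v k + \<beta> *\<^sub>R x k) \<le> R + \<beta> * R" for k
    using norm_triangle_ineq[of "v k" "\<beta> *\<^sub>R x k"] v_R[of k] mult_left_mono[OF x_R[of k] assms(10)]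
      assms(10) by simp
  have step_w: "0 = (1 / q ^ Suc k) *\<^sub>R (A (x (Suc k)) - (1 - \<tau>) *\<^sub>R A (x k))
      + (v (Suc k) + \<beta> *\<^sub>R x (Suc k) - (v k + \<beta> *\<^sub>R x k)) + g k" for k
    using step[of k] by (simp add: algebra_simps)
  obtain C where C: "\<And>k. norm (A (x k)) \<le> C * q ^ k"
    using linear_contracting_residual_rate[where a = "\<lambda>k. A (x k)",
        OF assms(7) q w_R g assms(12) step_w] by blast
  have "gap l T D x0 (x k) \<le> ereal ((C * (R + norm x0 + D)) * q ^ k)" for k
  proof -
    have "norm (x k - x0) + D \<le> R + norm x0 + D"
      using norm_triangle_ineq4[of "x k" x0] x_R[of k] by simp
    then have "norm (A (x k)) * (norm (x k - x0) + D) \<le> (C * q ^ k) * (R + norm x0 + D)"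
      using C[of k] \<open>D > 0\<close> order_trans[OF norm_ge_zero C[of k]] by (intro mult_mono) auto
    then have "ereal (norm (A (x k)) * (norm (x k - x0) + D)) \<le> ereal ((C * (R + norm x0 + D)) * q ^ k)"
      by (simp add: mult_ac)
    then show ?thesis
      using gap_le_of_monotone[of l T D x0 "x k"] mono unfolding A_def by (metis order_trans)
  qed
  with C show ?thesis unfolding A_def q_def by blast
qed

end
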